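(* Let $G$ be a connected compact Lie group, $\theta$ an involutive automorphism of $G$, and $M=G/G^{\theta}$. Let $X$ be a subset of $M$ containing the origin $o=eG^{\theta}\in M$. Then $X$ is a maximal antipodal set in $M$ if and only if both of the following hold: $F_{2}(X)$ is a maximal element (with respect to inclusion) in the set of elementary abelian $2$-subgroups of $\bar{G}$ which are generated by elements in $C_{\bar{\theta}}$, and $$X=\{x\in M:\ \phi(x)\in F_{2}(X)\cap C_{\bar{\theta}}\bar{\theta}^{-1}\}.$$
   Context: $G^{\theta}=\{g\in G:\theta(g)=g\}$, and $M=G/G^{\theta}$ is regarded as a compact symmetric space, whose geodesic symmetries are given by $s_{o}(gG^{\theta})=\theta(g)G^{\theta}$ at the origin $o=eG^{\theta}$ and, in general, by $s_{g_{1}G^{\theta}}(g_{2}G^{\theta})=g_{1}\theta(g_{1}^{-1}g_{2})G^{\theta}$. A nonempty subset $X\subset M$ is an antipodal set if $s_{x}(y)=y$ for all $x,y\in X$. It is a maximal antipodal set if it is an antipodal set not properly contained in any other antipodal set. $\bar{G}=G\rtimes\langle\bar{\theta}\rangle$ is the semidirect product in which $\bar{\theta}^{2}=1$ and $\bar\theta g\bar\theta^{-1}=\theta(g)$ for all $g\in G$. $C_{\bar{\theta}}=\{g\bar{\theta}g^{-1}:g\in G\}\subset\bar{G}$, and $C_{\bar{\theta}}\bar{\theta}^{-1}=\{c\,\bar{\theta}^{-1}:c\in C_{\bar{\theta}}\}$. The Cartan quadratic morphism is the well-defined map $\phi:G/G^{\theta}\rightarrow G$, $\phi(gG^{\theta})=g\theta(g)^{-1}$.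 For $X\subset M$ containing $o$, put $\phi(X)=\{\phi(x):x\in X\}\subset G$ and $F_{2}(X)=\langle\phi(X),\bar{\theta}\rangle\subset\bar{G}$, the subgroup generated by $\phi(X)$ and $\bar{\theta}$. *)

theory Defs
  imports "HOL-Analysis.Analysis" "HOL-Algebra.Left_Coset" "HOL-Algebra.Generated_Groups"
    "HOL-Algebra.Elementary_Groups"
begin

text \<open>The model space of a manifold is a finite-dimensional real normed
  vector space, given by a type; unlike \<open>real ^ 'n\<close> or class \<^class>\<open>euclidean_space\<close>, this also
  covers dimension 0, i.e. the trivial connected Lie group.\<close>

fun Ck_on :: "nat \<Rightarrow> 'e set \<Rightarrow> ('e::real_normed_vector \<Rightarrow> 'f::real_normed_vector) \<Rightarrow> bool" where
  "Ck_on 0 S f \<longleftrightarrow> continuous_on S f"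
| "Ck_on (Suc k) S f \<longleftrightarrow>
     (\<forall>x\<in>S. f differentiable (at x)) \<and> (\<forall>v. Ck_on k S (\<lambda>x. frechet_derivative f (at x) v))"

text \<open>Only to be used on open sets \<open>S\<close> of finite-dimensional spaces.\<close>

definition smooth_on :: "'e set \<Rightarrow> ('e::real_normed_vector \<Rightarrow> 'f::real_normed_vector) \<Rightarrow> bool" where
  "smooth_on S f \<longleftrightarrow> (\<forall>k. Ck_on k S f)"

type_synonym ('a, 'e) chart = "'a set \<times> ('a \<Rightarrow> 'e)"

definition is_chart :: "'a topology \<Rightarrow> ('a, 'e::real_normed_vector) chart \<Rightarrow> bool" where
  "is_chart T = (\<lambda>(U, c). openin T U \<and> open (c ` U) \<and>
     homeomorphic_map (subtopology T U) (top_of_set (c ` U)) c)"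

definition smooth_atlas :: "'a topology \<Rightarrow> ('a, 'e::real_normed_vector) chart set \<Rightarrow> bool" where
  "smooth_atlas T A \<longleftrightarrow>
     (\<forall>\<kappa>\<in>A. is_chart T \<kappa>) \<and>
     (\<Union>(U, c)\<in>A. U) = topspace T \<and>
     (\<forall>(U, c)\<in>A. \<forall>(V, d)\<in>A. smooth_on (c ` (U \<inter> V)) (d \<circ> inv_into U c))"

definition smooth_map ::
  "'a topology \<Rightarrow> ('a, 'e::real_normed_vector) chart set \<Rightarrow>
   'b topology \<Rightarrow> ('b, 'f::real_normed_vector) chart set \<Rightarrow> ('a \<Rightarrow> 'b) \<Rightarrow> bool" where
  "smooth_map T A T' B f \<longleftrightarrow>
     continuous_map T T' f \<and>
     (\<forall>(U, c)\<in>A. \<forall>(V, d)\<in>B. smooth_on (c ` {x \<in> U. f x \<in> V}) (d \<circ> f \<circ> inv_into U c))"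

definition prod_atlas ::
  "('a, 'e) chart set \<Rightarrow> ('b, 'f) chart set \<Rightarrow> ('a \<times> 'b, 'e \<times> 'f) chart set" where
  "prod_atlas A B = (\<lambda>((U, c), (V, d)). (U \<times> V, map_prod c d)) ` (A \<times> B)"

text \<open>The smooth structure is the one determined by \<open>A\<close>; the atlas need not be maximal.\<close>

locale lie_group = group G
  for G :: "('a, 'b) monoid_scheme" (structure)
    and T :: "'a topology"
    and A :: "('a, 'e::real_normed_vector) chart set" +
  assumes finite_dim_model: "\<exists>B :: 'e set. finite B \<and> span B = UNIV"
    and topspace_eq: "topspace T = carrier G"
    and Hausdorff: "Hausdorff_space T"
    and second_countable: "second_countable T"
    and atlas: "smooth_atlas T A"
    and smooth_mult: "smooth_map (prod_topology T T) (prod_atlas A A) T A (\<lambda>(x, y). x \<otimes> y)"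
    and smooth_inv: "smooth_map T A T A (\<lambda>x. inv x)"

text \<open>As usual, the identity automorphism is not excluded.\<close>

definition involutive_automorphism :: "('a, 'b) monoid_scheme \<Rightarrow> ('a \<Rightarrow> 'a) \<Rightarrow> bool" where
  "involutive_automorphism G \<theta> \<longleftrightarrow> \<theta> \<in> iso G G \<and> (\<forall>g\<in>carrier G. \<theta> (\<theta> g) = g)"


text \<open>The symmetric space \<open>G/G\<^sup>\<theta>\<close>, as a set of left cosets.\<close>

definition fixed_points :: "('a, 'b) monoid_scheme \<Rightarrow> ('a \<Rightarrow> 'a) \<Rightarrow> 'a set" where
  "fixed_points G \<theta> = {g \<in> carrier G. \<theta> g = g}"

definition sym_space :: "('a, 'b) monoid_scheme \<Rightarrow> ('a \<Rightarrow> 'a) \<Rightarrow> 'a set set" where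
  "sym_space G \<theta> = lcosets\<^bsub>G\<^esub> (fixed_points G \<theta>)"

definition origin :: "('a, 'b) monoid_scheme \<Rightarrow> ('a \<Rightarrow> 'a) \<Rightarrow> 'a set" where
  "origin G \<theta> = \<one>\<^bsub>G\<^esub> <#\<^bsub>G\<^esub> fixed_points G \<theta>"

text \<open>The next two maps are defined through coset representatives; lemmas \<open>geod_sym_coset\<close> and
  \<open>cartan_map_coset\<close> below show that they do not depend on the representatives.\<close>

definition geod_sym :: "('a, 'b) monoid_scheme \<Rightarrow> ('a \<Rightarrow> 'a) \<Rightarrow> 'a set \<Rightarrow> 'a set \<Rightarrow> 'a set" where
  "geod_sym G \<theta> x y =
     the_elem ((\<lambda>(g\<^sub>1, g\<^sub>2). (g\<^sub>1 \<otimes>\<^bsub>G\<^esub> \<theta> (inv\<^bsub>G\<^esub> g\<^sub>1 \<otimes>\<^bsub>G\<^esub> g\<^sub>2)) <#\<^bsub>G\<^esub> fixed_points G \<theta>) ` (x \<times> y))"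

definition cartan_map :: "('a, 'b) monoid_scheme \<Rightarrow> ('a \<Rightarrow> 'a) \<Rightarrow> 'a set \<Rightarrow> 'a" where
  "cartan_map G \<theta> x = the_elem ((\<lambda>g. g \<otimes>\<^bsub>G\<^esub> inv\<^bsub>G\<^esub> (\<theta> g)) ` x)"

definition antipodal_set :: "('a, 'b) monoid_scheme \<Rightarrow> ('a \<Rightarrow> 'a) \<Rightarrow> 'a set set \<Rightarrow> bool" where
  "antipodal_set G \<theta> X \<longleftrightarrow>
     X \<noteq> {} \<and> X \<subseteq> sym_space G \<theta> \<and> (\<forall>x\<in>X. \<forall>y\<in>X. geod_sym G \<theta> x y = y)"

definition maximal_antipodal_set ::
  "('a, 'b) monoid_scheme \<Rightarrow> ('a \<Rightarrow> 'a) \<Rightarrow> 'a set set \<Rightarrow> bool" where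
  "maximal_antipodal_set G \<theta> X \<longleftrightarrow>
     antipodal_set G \<theta> X \<and> \<not> (\<exists>Y. antipodal_set G \<theta> Y \<and> X \<subset> Y)"


text \<open>The semidirect product with a group of order 2, written additively as \<open>{0, 1}\<close> modulo 2,
  where \<open>i\<close> acts as \<open>\<theta>\<^sup>i\<close>.  Thus \<open>(g, i)\<close> stands for \<open>g\<close> times the \<open>i\<close>-th power of the
  adjoined element, which has order 2 even when \<open>\<theta>\<close> is the identity.\<close>

definition semidirect_product ::
  "('a, 'm) monoid_scheme \<Rightarrow> ('c, 'n) monoid_scheme \<Rightarrow> ('c \<Rightarrow> 'a \<Rightarrow> 'a) \<Rightarrow> ('a \<times> 'c) monoid" where
  "semidirect_product G H \<alpha> =
     \<lparr>carrier = carrier G \<times> carrier H,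
      mult = (\<lambda>(g, a) (h, b). (g \<otimes>\<^bsub>G\<^esub> \<alpha> a h, a \<otimes>\<^bsub>H\<^esub> b)),
      one = (\<one>\<^bsub>G\<^esub>, \<one>\<^bsub>H\<^esub>)\<rparr>"

definition ext_group :: "('a, 'b) monoid_scheme \<Rightarrow> ('a \<Rightarrow> 'a) \<Rightarrow> ('a \<times> int) monoid" where
  "ext_group G \<theta> = semidirect_product G (integer_mod_group 2) (\<lambda>i. \<theta> ^^ nat i)"

definition emb :: "'a \<Rightarrow> 'a \<times> int" where
  "emb g = (g, 0)"

definition theta_bar :: "('a, 'b) monoid_scheme \<Rightarrow> 'a \<times> int" where
  "theta_bar G = (\<one>\<^bsub>G\<^esub>, 1)"

definition theta_class :: "('a, 'b) monoid_scheme \<Rightarrow> ('a \<Rightarrow> 'a) \<Rightarrow> ('a \<times> int) set" where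
  "theta_class G \<theta> =
     {emb g \<otimes>\<^bsub>ext_group G \<theta>\<^esub> theta_bar G \<otimes>\<^bsub>ext_group G \<theta>\<^esub> inv\<^bsub>ext_group G \<theta>\<^esub> (emb g) | g. g \<in> carrier G}"

definition F2 :: "('a, 'b) monoid_scheme \<Rightarrow> ('a \<Rightarrow> 'a) \<Rightarrow> 'a set set \<Rightarrow> ('a \<times> int) set" where
  "F2 G \<theta> X = generate (ext_group G \<theta>) (emb ` cartan_map G \<theta> ` X \<union> {theta_bar G})"

definition elementary_abelian_2_subgroup :: "('a, 'b) monoid_scheme \<Rightarrow> 'a set \<Rightarrow> bool" where
  "elementary_abelian_2_subgroup G F \<longleftrightarrow>
     subgroup F G \<and> (\<forall>x\<in>F. \<forall>y\<in>F. x \<otimes>\<^bsub>G\<^esub> y = y \<otimes>\<^bsub>G\<^esub> x) \<and> (\<forall>x\<in>F. x \<otimes>\<^bsub>G\<^esub> x = \<one>\<^bsub>G\<^esub>)"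

definition theta_generated_elab ::
  "('a, 'b) monoid_scheme \<Rightarrow> ('a \<Rightarrow> 'a) \<Rightarrow> ('a \<times> int) set set" where
  "theta_generated_elab G \<theta> =
     {F. elementary_abelian_2_subgroup (ext_group G \<theta>) F \<and>
         (\<exists>S \<subseteq> theta_class G \<theta>. F = generate (ext_group G \<theta>) S)}"

definition maximal_element :: "'a set \<Rightarrow> 'a set set \<Rightarrow> bool" where
  "maximal_element F \<F> \<longleftrightarrow> F \<in> \<F> \<and> (\<forall>F'\<in>\<F>. F \<subseteq> F' \<longrightarrow> F' = F)"



context group
begin

lemma involutive_automorphism_group_hom:
  assumes "involutive_automorphism G \<theta>"
  shows "group_hom G G \<theta>"
  using assms is_group
  by (auto simp: involutive_automorphism_def iso_def group_hom_def group_hom_axioms_def)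

lemma subgroup_fixed_points:
  assumes "involutive_automorphism G \<theta>"
  shows "subgroup (fixed_points G \<theta>) G"
proof -
  interpret \<theta>: group_hom G G \<theta> by (rule involutive_automorphism_group_hom[OF assms])
  show ?thesis
    by (rule subgroupI) (auto simp: fixed_points_def intro!: exI[of _ \<one>])
qed

lemma coset_member:
  assumes "involutive_automorphism G \<theta>" "g \<in> carrier G" "g' \<in> g <# fixed_points G \<theta>"
  obtains h where "h \<in> carrier G" "\<theta> h = h" "g' = g \<otimes> h"
  using assms by (auto simp: l_coset_def fixed_points_def)

lemma coset_self:
  assumes "involutive_automorphism G \<theta>" "g \<in> carrier G"
  shows "g \<in> g <# fixed_points G \<theta>"
  using assms subgroup_fixed_points lcos_self by blast

lemma cartan_map_coset:
  assumes "involutive_automorphism G \<theta>" "g \<in> carrier G"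
  shows "cartan_map G \<theta> (g <# fixed_points G \<theta>) = g \<otimes> inv (\<theta> g)"
proof -
  interpret \<theta>: group_hom G G \<theta> by (rule involutive_automorphism_group_hom[OF assms(1)])
  have "g' \<otimes> inv (\<theta> g') = g \<otimes> inv (\<theta> g)" if g': "g' \<in> g <# fixed_points G \<theta>" for g'
  proof -
    obtain h where h: "h \<in> carrier G" "\<theta> h = h" "g' = g \<otimes> h"
      using coset_member[OF assms g'] by blast
    have "h \<otimes> (inv h \<otimes> z) = z" if "z \<in> carrier G" for z
      using that h(1) by (simp flip: m_assoc)
    then show ?thesis
      using h assms(2) by (simp add: inv_mult_group m_assoc)
  qed
  then have "(\<lambda>g. g \<otimes> inv (\<theta> g)) ` (g <# fixed_points G \<theta>) = {g \<otimes> inv (\<theta> g)}"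
    using coset_self[OF assms] by blast
  then show ?thesis
    by (simp add: cartan_map_def)
qed

lemma geod_sym_coset:
  assumes \<theta>: "involutive_automorphism G \<theta>" and g: "g\<^sub>1 \<in> carrier G" "g\<^sub>2 \<in> carrier G"
  shows "geod_sym G \<theta> (g\<^sub>1 <# fixed_points G \<theta>) (g\<^sub>2 <# fixed_points G \<theta>) =
    (g\<^sub>1 \<otimes> \<theta> (inv g\<^sub>1 \<otimes> g\<^sub>2)) <# fixed_points G \<theta>"
proof -
  interpret \<theta>: group_hom G G \<theta> by (rule involutive_automorphism_group_hom[OF \<theta>])
  let ?H = "fixed_points G \<theta>"
  let ?f = "\<lambda>(g\<^sub>1, g\<^sub>2). (g\<^sub>1 \<otimes> \<theta> (inv g\<^sub>1 \<otimes> g\<^sub>2)) <# ?H"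
  have "?f (a, b) = ?f (g\<^sub>1, g\<^sub>2)" if ab: "a \<in> g\<^sub>1 <# ?H" "b \<in> g\<^sub>2 <# ?H" for a b
  proof -
    obtain h where h: "h \<in> carrier G" "\<theta> h = h" "a = g\<^sub>1 \<otimes> h"
      using coset_member[OF \<theta> g(1) ab(1)] by blast
    obtain k where k: "k \<in> carrier G" "\<theta> k = k" "b = g\<^sub>2 \<otimes> k"
      using coset_member[OF \<theta> g(2) ab(2)] by blast
    have "h \<otimes> (inv h \<otimes> z) = z" if "z \<in> carrier G" for z
      using that h(1) by (simp flip: m_assoc)
    then have eq: "a \<otimes> \<theta> (inv a \<otimes> b) = g\<^sub>1 \<otimes> \<theta> (inv g\<^sub>1 \<otimes> g\<^sub>2) \<otimes> k"
      using h k g by (simp add: inv_mult_group m_assoc)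
    have sub: "?H \<subseteq> carrier G" by (auto simp: fixed_points_def)
    have "k <# ?H = ?H"
      using k subgroup_fixed_points[OF \<theta>] by (intro coset_join3) (auto simp: fixed_points_def)
    then show ?thesis
      using eq k g sub by (simp add: lcos_m_assoc[symmetric])
  qed
  then have "?f ` ((g\<^sub>1 <# ?H) \<times> (g\<^sub>2 <# ?H)) = {?f (g\<^sub>1, g\<^sub>2)}"
    using coset_self[OF \<theta> g(1)] coset_self[OF \<theta> g(2)] by blast
  then show ?thesis
    by (simp add: geod_sym_def)
qed

lemma group_ext_group:
  assumes \<theta>: "involutive_automorphism G \<theta>"
  shows "group (ext_group G \<theta>)"
proof -
  interpret \<theta>: group_hom G G \<theta> by (rule involutive_automorphism_group_hom[OF \<theta>])
  have inv: "\<theta> (\<theta> g) = g" if "g \<in> carrier G" for g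
    using \<theta> that by (simp add: involutive_automorphism_def)
  have "carrier (integer_mod_group 2) = {0, 1}"
    by (auto simp: carrier_integer_mod_group)
  note defs = ext_group_def semidirect_product_def this
  show ?thesis
  proof (rule groupI)
    fix x assume "x \<in> carrier (ext_group G \<theta>)"
    then obtain g i where x: "x = (g, i)" "g \<in> carrier G" "i = 0 \<or> i = 1"
      by (auto simp: defs)
    show "\<exists>y\<in>carrier (ext_group G \<theta>). y \<otimes>\<^bsub>ext_group G \<theta>\<^esub> x = \<one>\<^bsub>ext_group G \<theta>\<^esub>"
      using x by (intro bexI[of _ "(inv ((\<theta> ^^ nat i) g), i)"]) (auto simp: defs)
  qed (auto simp: defs m_assoc inv)
qed

lemma theta_bar_relations:
  assumes \<theta>: "involutive_automorphism G \<theta>"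
  shows "theta_bar G \<otimes>\<^bsub>ext_group G \<theta>\<^esub> theta_bar G = \<one>\<^bsub>ext_group G \<theta>\<^esub>"
    and "g \<in> carrier G \<Longrightarrow>
      theta_bar G \<otimes>\<^bsub>ext_group G \<theta>\<^esub> emb g \<otimes>\<^bsub>ext_group G \<theta>\<^esub> inv\<^bsub>ext_group G \<theta>\<^esub> theta_bar G = emb (\<theta> g)"
proof -
  interpret \<theta>: group_hom G G \<theta> by (rule involutive_automorphism_group_hom[OF \<theta>])
  interpret E: group "ext_group G \<theta>" by (rule group_ext_group[OF \<theta>])
  note defs = ext_group_def semidirect_product_def theta_bar_def emb_def carrier_integer_mod_group
  show sq: "theta_bar G \<otimes>\<^bsub>ext_group G \<theta>\<^esub> theta_bar G = \<one>\<^bsub>ext_group G \<theta>\<^esub>"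
    by (simp add: defs)
  have "theta_bar G \<in> carrier (ext_group G \<theta>)"
    by (simp add: defs)
  then have inv: "inv\<^bsub>ext_group G \<theta>\<^esub> theta_bar G = theta_bar G"
    using sq by (intro E.inv_equality)
  show "theta_bar G \<otimes>\<^bsub>ext_group G \<theta>\<^esub> emb g \<otimes>\<^bsub>ext_group G \<theta>\<^esub> inv\<^bsub>ext_group G \<theta>\<^esub> theta_bar G = emb (\<theta> g)"
    if "g \<in> carrier G"
    using that unfolding inv by (simp add: defs)
qed

end

end

theory Submission
  imports Defs
begin

text \<open>
  Write \<open>t\<close> for the adjoined involution of the extended group and \<open>H\<close> for the fixed point group.
  The stabiliser of \<open>t\<close> under conjugation by elements of \<open>G\<close> is exactly \<open>H\<close>, so
  \<open>g H \<mapsto> g t g\<^sup>-\<^sup>1\<close> is a bijection \<open>\<rho>\<close> from the symmetric space onto the class of \<open>t\<close>.  It differs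
  from the Cartan map only by the factor \<open>t\<close>, since \<open>g t g\<^sup>-\<^sup>1 = g \<theta>(g)\<^sup>-\<^sup>1 t\<close>.  The reason for
  preferring \<open>\<rho>\<close> is that it turns the geodesic symmetry at \<open>x\<close> into conjugation by \<open>\<rho> x\<close>
  (lemma \<open>reflection_geod_sym\<close>).  Hence \<open>s\<^sub>x\<close> fixes \<open>y\<close> if and only if \<open>\<rho> x\<close> and \<open>\<rho> y\<close> commute,
  and the antipodal sets are the nonempty sets \<open>X\<close> for which \<open>\<rho> X\<close> is commuting.  If \<open>X\<close>
  contains the origin, then \<open>t\<close> belongs to \<open>\<rho> X\<close> and \<open>F\<^sub>2(X)\<close> is the group generated by \<open>\<rho> X\<close>.

  What remains concerns a set \<open>C\<close> of involutions in an arbitrary group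
  (lemma \<open>maximal_commuting_iff\<close>).  Commuting subsets of \<open>C\<close> generate elementary abelian
  \<open>2\<close>-groups, and an elementary abelian \<open>2\<close>-group meets \<open>C\<close> in a commuting set.  Generating and
  intersecting both preserve inclusion, \<open>S \<subseteq> \<langle>S\<rangle> \<inter> C\<close>, and \<open>F = \<langle>F \<inter> C\<rangle>\<close> whenever \<open>F\<close> is generated
  by elements of \<open>C\<close>; so the two operations match the maximal commuting subsets with the maximal
  groups of this kind.
\<close>

section \<open>Commuting sets of involutions\<close>

definition commuting :: "('a, 'b) monoid_scheme \<Rightarrow> 'a set \<Rightarrow> bool" where
  "commuting G S \<longleftrightarrow> (\<forall>x\<in>S. \<forall>y\<in>S. x \<otimes>\<^bsub>G\<^esub> y = y \<otimes>\<^bsub>G\<^esub> x)"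

lemma (in group) subgroup_centralizer:
  assumes "S \<subseteq> carrier G"
  shows "subgroup {a \<in> carrier G. \<forall>b\<in>S. a \<otimes> b = b \<otimes> a} G"
proof (rule subgroupI)
  fix a assume a: "a \<in> {a \<in> carrier G. \<forall>b\<in>S. a \<otimes> b = b \<otimes> a}"
  have "inv a \<otimes> b = b \<otimes> inv a" if "b \<in> S" for b
  proof -
    have ab: "a \<in> carrier G" "b \<in> carrier G" "a \<otimes> b = b \<otimes> a"
      using a that assms by auto
    have "inv a \<otimes> b = inv a \<otimes> (b \<otimes> a) \<otimes> inv a"
      using ab(1,2) by (simp add: m_assoc)
    also have "\<dots> = b \<otimes> inv a"
      unfolding ab(3)[symmetric] using ab(1,2) by (simp flip: m_assoc)
    finally show ?thesis .
  qed
  with a show "inv a \<in> {a \<in> carrier G. \<forall>b\<in>S. a \<otimes> b = b \<otimes> a}"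
    by simp
next
  fix a b assume ab: "a \<in> {a \<in> carrier G. \<forall>b\<in>S. a \<otimes> b = b \<otimes> a}"
    "b \<in> {a \<in> carrier G. \<forall>b\<in>S. a \<otimes> b = b \<otimes> a}"
  have "a \<otimes> b \<otimes> c = c \<otimes> (a \<otimes> b)" if "c \<in> S" for c
  proof -
    have c: "c \<in> carrier G" "a \<otimes> c = c \<otimes> a" "b \<otimes> c = c \<otimes> b"
      using ab that assms by auto
    have "a \<otimes> b \<otimes> c = a \<otimes> c \<otimes> b"
      using ab c(1,3) by (simp add: m_assoc)
    also have "\<dots> = c \<otimes> (a \<otimes> b)"
      using ab c(1,2) by (simp add: m_assoc)
    finally show ?thesis .
  qed
  with ab show "a \<otimes> b \<in> {a \<in> carrier G. \<forall>b\<in>S. a \<otimes> b = b \<otimes> a}"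
    by simp
qed (use assms in \<open>auto intro!: exI[of _ \<one>]\<close>)

text \<open>The centralizer of \<open>S\<close> contains \<open>S\<close>, hence the generated group \<open>\<langle>S\<rangle>\<close>; so \<open>S\<close> lies in the
  centralizer of \<open>\<langle>S\<rangle>\<close>, and repeating the argument \<open>\<langle>S\<rangle>\<close> does too.\<close>

lemma (in group) commuting_generate:
  assumes S: "S \<subseteq> carrier G" and comm: "commuting G S"
  shows "commuting G (generate G S)"
proof -
  have "generate G S \<subseteq> {a \<in> carrier G. \<forall>b\<in>S. a \<otimes> b = b \<otimes> a}"
    using S comm by (intro generate_subgroup_incl subgroup_centralizer) (auto simp: commuting_def)
  then have "S \<subseteq> {a \<in> carrier G. \<forall>b\<in>generate G S. a \<otimes> b = b \<otimes> a}"
    using S by fastforce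
  then have "generate G S \<subseteq> {a \<in> carrier G. \<forall>b\<in>generate G S. a \<otimes> b = b \<otimes> a}"
    by (rule generate_subgroup_incl[OF _ subgroup_centralizer[OF generate_incl[OF S]]])
  then show ?thesis
    unfolding commuting_def by blast
qed

lemma (in group) elementary_abelian_2_generate:
  assumes S: "S \<subseteq> carrier G" and comm: "commuting G S"
    and invol: "\<And>s. s \<in> S \<Longrightarrow> s \<otimes> s = \<one>"
  shows "elementary_abelian_2_subgroup G (generate G S)"
proof -
  note comm' = commuting_generate[OF S comm]
  have "x \<otimes> x = \<one>" if "x \<in> generate G S" for x
    using that
  proof induction
    case (inv h)
    then have "inv h = h"
      using S invol by (intro inv_equality) auto
    with inv show ?case
      using invol by simp
  next
    case (eng a b)
    have ab: "a \<in> carrier G" "b \<in> carrier G"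
      using eng.hyps generate_in_carrier[OF S] by auto
    have ba: "b \<otimes> a = a \<otimes> b"
      using eng.hyps comm' by (simp add: commuting_def)
    have "a \<otimes> b \<otimes> (a \<otimes> b) = a \<otimes> (b \<otimes> a) \<otimes> b"
      using ab by (simp add: m_assoc)
    also have "\<dots> = (a \<otimes> a) \<otimes> (b \<otimes> b)"
      unfolding ba using ab by (simp add: m_assoc)
    finally show ?case
      using eng.IH by simp
  qed (use invol in auto)
  then show ?thesis
    using comm' generate_is_subgroup[OF S]
    by (simp add: elementary_abelian_2_subgroup_def commuting_def)
qed

text \<open>If \<open>S\<close> is maximal and \<open>F\<close> in \<open>\<F>\<close> contains \<open>S\<close>, then the commuting set \<open>F \<inter> C\<close> must be \<open>S\<close>
  itself, so all generators of \<open>F\<close> lie in \<open>S\<close>.  Conversely, a commuting \<open>S' \<supseteq> S\<close> cannot enlarge the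
  generated group, so \<open>S' \<subseteq> \<langle>S\<rangle> \<inter> C = S\<close>.  The condition \<open>S = \<langle>S\<rangle> \<inter> C\<close> cannot be left out of the right-hand side: a smaller set may
  generate the same group.\<close>

lemma (in group) maximal_commuting_iff:
  assumes C: "C \<subseteq> carrier G" and invol: "\<And>c. c \<in> C \<Longrightarrow> c \<otimes> c = \<one>" and SC: "S \<subseteq> C"
  defines "\<F> \<equiv> {F. elementary_abelian_2_subgroup G F \<and> (\<exists>S\<subseteq>C. F = generate G S)}"
  shows "commuting G S \<and> (\<forall>S'\<subseteq>C. commuting G S' \<and> S \<subseteq> S' \<longrightarrow> S' = S) \<longleftrightarrow>
    maximal_element (generate G S) \<F> \<and> S = generate G S \<inter> C"
proof (intro iffI conjI allI impI; (elim conjE)?)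
  have gen: "generate G S' \<in> \<F>" if "S' \<subseteq> C" "commuting G S'" for S'
    using that C invol elementary_abelian_2_generate[of S'] unfolding \<F>_def by blast
  have comm: "commuting G (F \<inter> C)" if "F \<in> \<F>" for F
    using that by (auto simp: \<F>_def elementary_abelian_2_subgroup_def commuting_def)
  have incl: "S' \<subseteq> generate G S'" for S'
    by (auto intro: generate.incl)
  {
    assume S: "commuting G S"
      and max: "\<forall>S'\<subseteq>C. commuting G S' \<and> S \<subseteq> S' \<longrightarrow> S' = S"
    have meet: "F \<inter> C = S" if "F \<in> \<F>" "S \<subseteq> F" for F
      using max comm[OF that(1)] that(2) SC by simp
    show "S = generate G S \<inter> C"
      using meet[OF gen[OF SC S] incl] by simp
    show "maximal_element (generate G S) \<F>"
      unfolding maximal_element_def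
    proof (intro conjI ballI impI gen SC S)
      fix F assume F: "F \<in> \<F>" "generate G S \<subseteq> F"
      then obtain S' where S': "S' \<subseteq> C" "F = generate G S'"
        by (auto simp: \<F>_def)
      have "S' \<subseteq> S"
        using meet[OF F(1)] F(2) incl[of S] incl[of S'] S' by blast
      then show "F = generate G S"
        using F(2) mono_generate S'(2) by blast
    qed
  }
  assume max: "maximal_element (generate G S) \<F>" and S: "S = generate G S \<inter> C"
  show "commuting G S"
    using comm[of "generate G S"] max S by (simp add: maximal_element_def)
  fix S' assume S': "S' \<subseteq> C" "commuting G S'" "S \<subseteq> S'"
  then have "generate G S' = generate G S"
    using max gen[OF S'(1,2)] mono_generate[OF S'(3)] by (simp add: maximal_element_def)
  then have "S' \<subseteq> S"
    using incl[of S'] S'(1) S by blast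
  with S'(3) show "S' = S"
    by simp
qed

section \<open>Points of the symmetric space as involutions\<close>

text \<open>This is the bijection \<open>\<rho>\<close>, written through the Cartan map; on cosets it is
  \<open>g H \<mapsto> g t g\<^sup>-\<^sup>1\<close> (lemma \<open>reflection_coset\<close>).\<close>

definition reflection :: "('a, 'b) monoid_scheme \<Rightarrow> ('a \<Rightarrow> 'a) \<Rightarrow> 'a set \<Rightarrow> 'a \<times> int" where
  "reflection G \<theta> x = emb (cartan_map G \<theta> x) \<otimes>\<^bsub>ext_group G \<theta>\<^esub> theta_bar G"

context group
begin

context
  fixes \<theta>
  assumes \<theta>: "involutive_automorphism G \<theta>"
begin

interpretation \<theta>: group_hom G G \<theta>
  by (rule involutive_automorphism_group_hom[OF \<theta>])

interpretation E: group "ext_group G \<theta>"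
  by (rule group_ext_group[OF \<theta>])

lemma theta_theta: "g \<in> carrier G \<Longrightarrow> \<theta> (\<theta> g) = g"
  using \<theta> by (simp add: involutive_automorphism_def)

lemma carrier_ext_group: "carrier (ext_group G \<theta>) = carrier G \<times> {0, 1}"
  by (auto simp: ext_group_def semidirect_product_def carrier_integer_mod_group)

lemma one_ext_group: "\<one>\<^bsub>ext_group G \<theta>\<^esub> = (\<one>, 0)"
  by (simp add: ext_group_def semidirect_product_def)

lemma mult_ext_group:
  "(g, 0) \<otimes>\<^bsub>ext_group G \<theta>\<^esub> (h, 1) = (g \<otimes> h, 1)"
  "(g, 0) \<otimes>\<^bsub>ext_group G \<theta>\<^esub> (h, 0) = (g \<otimes> h, 0)"
  "(g, 1) \<otimes>\<^bsub>ext_group G \<theta>\<^esub> (h, 0) = (g \<otimes> \<theta> h, 1)"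
  "(g, 1) \<otimes>\<^bsub>ext_group G \<theta>\<^esub> (h, 1) = (g \<otimes> \<theta> h, 0)"
  by (simp_all add: ext_group_def semidirect_product_def)

lemma theta_bar_carrier: "theta_bar G \<in> carrier (ext_group G \<theta>)"
  by (simp add: carrier_ext_group theta_bar_def)

lemma emb_carrier: "g \<in> carrier G \<Longrightarrow> emb g \<in> carrier (ext_group G \<theta>)"
  by (simp add: carrier_ext_group emb_def)

lemma inv_emb: "g \<in> carrier G \<Longrightarrow> inv\<^bsub>ext_group G \<theta>\<^esub> emb g = emb (inv g)"
  by (rule E.inv_equality)
    (simp_all add: emb_def mult_ext_group one_ext_group carrier_ext_group)

lemma sym_space_cases:
  assumes "x \<in> sym_space G \<theta>"
  obtains g where "g \<in> carrier G" "x = g <# fixed_points G \<theta>"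
  using assms by (auto simp: sym_space_def LCOSETS_def)

lemma coset_in_sym_space: "g \<in> carrier G \<Longrightarrow> g <# fixed_points G \<theta> \<in> sym_space G \<theta>"
  by (auto simp: sym_space_def LCOSETS_def)

lemma cartan_map_carrier: "x \<in> sym_space G \<theta> \<Longrightarrow> cartan_map G \<theta> x \<in> carrier G"
  by (auto elim!: sym_space_cases simp: cartan_map_coset[OF \<theta>])

lemma reflection_eq:
  "x \<in> sym_space G \<theta> \<Longrightarrow> reflection G \<theta> x = (cartan_map G \<theta> x, 1)"
  by (simp add: reflection_def emb_def theta_bar_def mult_ext_group cartan_map_carrier)

lemma reflection_coset:
  assumes "g \<in> carrier G"
  shows "reflection G \<theta> (g <# fixed_points G \<theta>) =
    emb g \<otimes>\<^bsub>ext_group G \<theta>\<^esub> theta_bar G \<otimes>\<^bsub>ext_group G \<theta>\<^esub> inv\<^bsub>ext_group G \<theta>\<^esub> (emb g)"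
  using assms
  by (simp add: reflection_eq coset_in_sym_space cartan_map_coset[OF \<theta>] inv_emb)
    (simp add: emb_def theta_bar_def mult_ext_group)

lemma reflection_image: "reflection G \<theta> ` sym_space G \<theta> = theta_class G \<theta>"
proof -
  have "sym_space G \<theta> = (\<lambda>g. g <# fixed_points G \<theta>) ` carrier G"
    by (auto elim: sym_space_cases intro: coset_in_sym_space)
  then have "reflection G \<theta> ` sym_space G \<theta> =
      (\<lambda>g. reflection G \<theta> (g <# fixed_points G \<theta>)) ` carrier G"
    by (simp add: image_image)
  also have "\<dots> = theta_class G \<theta>"
    by (auto simp: theta_class_def reflection_coset)
  finally show ?thesis .
qed

text \<open>If \<open>g \<theta>(g)\<^sup>-\<^sup>1 = h \<theta>(h)\<^sup>-\<^sup>1\<close>, then \<open>h\<^sup>-\<^sup>1 g\<close> is fixed by \<open>\<theta>\<close>.\<close>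

lemma inj_on_reflection: "inj_on (reflection G \<theta>) (sym_space G \<theta>)"
proof (rule inj_onI)
  fix x y assume xy: "x \<in> sym_space G \<theta>" "y \<in> sym_space G \<theta>"
    and eq: "reflection G \<theta> x = reflection G \<theta> y"
  obtain g where g: "g \<in> carrier G" "x = g <# fixed_points G \<theta>"
    using xy(1) by (rule sym_space_cases)
  obtain h where h: "h \<in> carrier G" "y = h <# fixed_points G \<theta>"
    using xy(2) by (rule sym_space_cases)
  have "g \<otimes> inv (\<theta> g) = h \<otimes> inv (\<theta> h)"
    using eq xy g h by (simp add: reflection_eq cartan_map_coset[OF \<theta>])
  then have "g \<otimes> inv (\<theta> g) \<otimes> \<theta> g = h \<otimes> inv (\<theta> h) \<otimes> \<theta> g"
    by simp
  then have "g = h \<otimes> (inv (\<theta> h) \<otimes> \<theta> g)"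
    using g(1) h(1) by (simp add: m_assoc)
  then have fixed: "inv h \<otimes> g = inv (\<theta> h) \<otimes> \<theta> g"
    using g(1) h(1) by (intro iffD2[OF inv_solve_left']) simp_all
  have "inv h \<otimes> g \<in> fixed_points G \<theta>"
    using g(1) h(1) by (simp add: fixed_points_def flip: fixed)
  moreover have "g = h \<otimes> (inv h \<otimes> g)"
    using g(1) h(1) by (simp flip: m_assoc)
  ultimately have "g \<in> h <# fixed_points G \<theta>"
    unfolding l_coset_def by blast
  then show "x = y"
    using g h l_repr_independence[OF _ _ subgroup_fixed_points[OF \<theta>]] by metis
qed

lemma reflection_carrier: "x \<in> sym_space G \<theta> \<Longrightarrow> reflection G \<theta> x \<in> carrier (ext_group G \<theta>)"
  by (simp add: reflection_eq carrier_ext_group cartan_map_carrier)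

lemma theta_cartan_map:
  "x \<in> sym_space G \<theta> \<Longrightarrow> \<theta> (cartan_map G \<theta> x) = inv (cartan_map G \<theta> x)"
  by (auto elim!: sym_space_cases simp: cartan_map_coset[OF \<theta>] theta_theta inv_mult_group)

lemma reflection_square:
  "x \<in> sym_space G \<theta> \<Longrightarrow>
    reflection G \<theta> x \<otimes>\<^bsub>ext_group G \<theta>\<^esub> reflection G \<theta> x = \<one>\<^bsub>ext_group G \<theta>\<^esub>"
  by (simp add: reflection_eq mult_ext_group one_ext_group theta_cartan_map cartan_map_carrier)

lemma geod_sym_closed:
  assumes "x \<in> sym_space G \<theta>" "y \<in> sym_space G \<theta>"
  shows "geod_sym G \<theta> x y \<in> sym_space G \<theta>"
  using assms
  by (auto elim!: sym_space_cases simp: geod_sym_coset[OF \<theta>] simp del: \<theta>.hom_mult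
      intro!: coset_in_sym_space)

text \<open>For \<open>x = a H\<close> the coset \<open>s\<^sub>x(g H)\<close> is represented by
  \<open>a \<theta>(a\<^sup>-\<^sup>1 g) = a t a\<^sup>-\<^sup>1 g t\<^sup>-\<^sup>1 = \<rho>(x) g t\<^sup>-\<^sup>1\<close>, and conjugating \<open>t\<close> by this element gives
  \<open>\<rho>(x) \<rho>(g H) \<rho>(x)\<^sup>-\<^sup>1\<close>.  In terms of the Cartan map the identity is
  \<open>\<phi>(s\<^sub>x y) = \<phi>(x) \<phi>(y)\<^sup>-\<^sup>1 \<phi>(x)\<close>, which can be checked inside \<open>G\<close>.\<close>

lemma reflection_geod_sym:
  assumes x: "x \<in> sym_space G \<theta>" and y: "y \<in> sym_space G \<theta>"
  shows "reflection G \<theta> (geod_sym G \<theta> x y) \<otimes>\<^bsub>ext_group G \<theta>\<^esub> reflection G \<theta> x =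
    reflection G \<theta> x \<otimes>\<^bsub>ext_group G \<theta>\<^esub> reflection G \<theta> y"
proof -
  obtain g where g: "g \<in> carrier G" "x = g <# fixed_points G \<theta>"
    using x by (rule sym_space_cases)
  obtain h where h: "h \<in> carrier G" "y = h <# fixed_points G \<theta>"
    using y by (rule sym_space_cases)
  have cancel: "inv a \<otimes> (a \<otimes> z) = z" if "a \<in> carrier G" "z \<in> carrier G" for a z
    using that by (simp flip: m_assoc)
  have "geod_sym G \<theta> x y = (g \<otimes> \<theta> (inv g \<otimes> h)) <# fixed_points G \<theta>"
    using g h by (simp add: geod_sym_coset[OF \<theta>])
  then have "cartan_map G \<theta> (geod_sym G \<theta> x y) =
      cartan_map G \<theta> x \<otimes> inv (cartan_map G \<theta> y) \<otimes> cartan_map G \<theta> x"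
    using g h by (simp add: cartan_map_coset[OF \<theta>] theta_theta inv_mult_group m_assoc cancel)
  then show ?thesis
    using x y cartan_map_carrier[OF x] cartan_map_carrier[OF y]
    by (simp add: reflection_eq geod_sym_closed mult_ext_group theta_cartan_map m_assoc)
qed

lemma geod_sym_fixed_iff:
  assumes x: "x \<in> sym_space G \<theta>" and y: "y \<in> sym_space G \<theta>"
  shows "geod_sym G \<theta> x y = y \<longleftrightarrow>
    reflection G \<theta> x \<otimes>\<^bsub>ext_group G \<theta>\<^esub> reflection G \<theta> y =
    reflection G \<theta> y \<otimes>\<^bsub>ext_group G \<theta>\<^esub> reflection G \<theta> x"
proof -
  have "geod_sym G \<theta> x y = y \<longleftrightarrow> reflection G \<theta> (geod_sym G \<theta> x y) = reflection G \<theta> y"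
    using inj_on_reflection geod_sym_closed[OF x y] y by (auto dest: inj_onD)
  also have "\<dots> \<longleftrightarrow> reflection G \<theta> (geod_sym G \<theta> x y) \<otimes>\<^bsub>ext_group G \<theta>\<^esub> reflection G \<theta> x =
      reflection G \<theta> y \<otimes>\<^bsub>ext_group G \<theta>\<^esub> reflection G \<theta> x"
    using x y geod_sym_closed[OF x y] by (simp add: reflection_carrier)
  finally show ?thesis
    by (simp add: reflection_geod_sym[OF x y])
qed

section \<open>Maximal antipodal sets\<close>

lemma antipodal_set_iff:
  assumes "X \<subseteq> sym_space G \<theta>" "X \<noteq> {}"
  shows "antipodal_set G \<theta> X \<longleftrightarrow> commuting (ext_group G \<theta>) (reflection G \<theta> ` X)"
proof -
  have "(\<forall>x\<in>X. \<forall>y\<in>X. geod_sym G \<theta> x y = y) \<longleftrightarrow> commuting (ext_group G \<theta>) (reflection G \<theta> ` X)"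
    unfolding commuting_def ball_simps
    using assms geod_sym_fixed_iff by (intro ball_cong refl) blast
  with assms show ?thesis
    by (simp add: antipodal_set_def)
qed

lemma maximal_antipodal_set_iff:
  assumes X: "X \<subseteq> sym_space G \<theta>" "X \<noteq> {}"
  defines "S \<equiv> reflection G \<theta> ` X"
  shows "maximal_antipodal_set G \<theta> X \<longleftrightarrow> commuting (ext_group G \<theta>) S \<and>
    (\<forall>S'\<subseteq>theta_class G \<theta>. commuting (ext_group G \<theta>) S' \<and> S \<subseteq> S' \<longrightarrow> S' = S)"
proof -
  have antipodal_sub: "Y \<subseteq> sym_space G \<theta>" if "antipodal_set G \<theta> Y" for Y
    using that unfolding antipodal_set_def by simp
  have "maximal_antipodal_set G \<theta> X \<longleftrightarrow> antipodal_set G \<theta> X \<and>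
      (\<forall>Y\<subseteq>sym_space G \<theta>. antipodal_set G \<theta> Y \<and> X \<subseteq> Y \<longrightarrow> Y = X)"
    using antipodal_sub unfolding maximal_antipodal_set_def psubset_eq by metis
  also have "\<dots> \<longleftrightarrow> commuting (ext_group G \<theta>) S \<and>
      (\<forall>Y\<subseteq>sym_space G \<theta>. commuting (ext_group G \<theta>) (reflection G \<theta> ` Y) \<and>
        S \<subseteq> reflection G \<theta> ` Y \<longrightarrow> reflection G \<theta> ` Y = S)"
  proof -
    have transfer: "(antipodal_set G \<theta> Y \<and> X \<subseteq> Y \<longrightarrow> Y = X) \<longleftrightarrow>
        (commuting (ext_group G \<theta>) (reflection G \<theta> ` Y) \<and> S \<subseteq> reflection G \<theta> ` Y \<longrightarrow>
          reflection G \<theta> ` Y = S)" if Y: "Y \<subseteq> sym_space G \<theta>" for Y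
    proof -
      have incl: "S \<subseteq> reflection G \<theta> ` Y \<longleftrightarrow> X \<subseteq> Y"
        unfolding S_def using X(1) Y by (rule inj_on_image_subset_iff[OF inj_on_reflection])
      have eq: "reflection G \<theta> ` Y = S \<longleftrightarrow> Y = X"
        unfolding S_def using Y X(1) by (rule inj_on_image_eq_iff[OF inj_on_reflection])
      show ?thesis
      proof (cases "X \<subseteq> Y")
        case True
        with X(2) have "Y \<noteq> {}"
          by blast
        then show ?thesis
          using incl eq antipodal_set_iff[OF Y] by simp
      qed (simp add: incl)
    qed
    show ?thesis
      using antipodal_set_iff[OF X] unfolding S_def[symmetric]
      by (intro conj_cong all_cong transfer)
  qed
  also have "\<dots> \<longleftrightarrow> commuting (ext_group G \<theta>) S \<and>
    (\<forall>S'\<subseteq>theta_class G \<theta>. commuting (ext_group G \<theta>) S' \<and> S \<subseteq> S' \<longrightarrow> S' = S)"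
    by (simp add: all_subset_image flip: reflection_image)
  finally show ?thesis .
qed

text \<open>Both groups contain \<open>t\<close>, the second one because \<open>\<rho>\<close> sends the origin to \<open>t\<close>; and once \<open>t\<close> is
  available, \<open>\<phi>(x)\<close> and \<open>\<rho>(x) = \<phi>(x) t\<close> generate each other.\<close>

lemma F2_eq_generate_reflection:
  assumes X: "X \<subseteq> sym_space G \<theta>" and o: "origin G \<theta> \<in> X"
  shows "F2 G \<theta> X = generate (ext_group G \<theta>) (reflection G \<theta> ` X)"
proof
  let ?E = "ext_group G \<theta>" and ?S = "reflection G \<theta> ` X"
  have SE: "?S \<subseteq> carrier ?E"
    using X reflection_carrier by blast
  have "reflection G \<theta> (origin G \<theta>) = theta_bar G"
    unfolding origin_def
    by (simp add: reflection_eq coset_in_sym_space cartan_map_coset[OF \<theta>] theta_bar_def)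
  then have tS: "theta_bar G \<in> generate ?E ?S"
    using o by (metis generate.incl imageI)
  have emb: "emb (cartan_map G \<theta> x) =
      reflection G \<theta> x \<otimes>\<^bsub>?E\<^esub> inv\<^bsub>?E\<^esub> theta_bar G" if "x \<in> X" for x
    using that X cartan_map_carrier[of x] emb_carrier theta_bar_carrier
    by (simp add: reflection_def E.m_assoc subset_iff)
  have "emb (cartan_map G \<theta> x) \<in> generate ?E ?S" if "x \<in> X" for x
    unfolding emb[OF that]
    using that tS E.generate_m_inv_closed[OF SE tS] by (auto intro: generate.intros)
  then show "F2 G \<theta> X \<subseteq> generate ?E ?S"
    unfolding F2_def using tS E.generate_is_subgroup[OF SE]
    by (intro E.generate_subgroup_incl) auto
  have "emb ` cartan_map G \<theta> ` X \<union> {theta_bar G} \<subseteq> carrier ?E"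
    using X cartan_map_carrier emb_carrier theta_bar_carrier by auto
  then have "subgroup (F2 G \<theta> X) ?E"
    unfolding F2_def by (rule E.generate_is_subgroup)
  moreover have "?S \<subseteq> F2 G \<theta> X"
    unfolding F2_def reflection_def by (blast intro: generate.intros)
  ultimately show "generate ?E ?S \<subseteq> F2 G \<theta> X"
    by (intro E.generate_subgroup_incl)
qed

lemma emb_cartan_map_in_class:
  assumes x: "x \<in> sym_space G \<theta>"
  shows "emb (cartan_map G \<theta> x) \<in>
    theta_class G \<theta> #>\<^bsub>ext_group G \<theta>\<^esub> inv\<^bsub>ext_group G \<theta>\<^esub> theta_bar G"
proof -
  have "emb (cartan_map G \<theta> x) =
      reflection G \<theta> x \<otimes>\<^bsub>ext_group G \<theta>\<^esub> inv\<^bsub>ext_group G \<theta>\<^esub> theta_bar G"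
    using emb_carrier[OF cartan_map_carrier[OF x]] theta_bar_carrier
    by (simp add: reflection_def E.m_assoc)
  moreover have "reflection G \<theta> x \<in> theta_class G \<theta>"
    using x reflection_image by blast
  ultimately show ?thesis
    unfolding r_coset_def by blast
qed

lemma maximal_antipodal_set_iff_maximal_F2:
  assumes X: "X \<subseteq> sym_space G \<theta>" and o: "origin G \<theta> \<in> X"
  shows "maximal_antipodal_set G \<theta> X \<longleftrightarrow>
    maximal_element (F2 G \<theta> X) (theta_generated_elab G \<theta>) \<and>
    X = {x \<in> sym_space G \<theta>. emb (cartan_map G \<theta> x) \<in>
           F2 G \<theta> X \<inter> (theta_class G \<theta> #>\<^bsub>ext_group G \<theta>\<^esub> inv\<^bsub>ext_group G \<theta>\<^esub> theta_bar G)}"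
proof -
  let ?E = "ext_group G \<theta>" and ?F = "F2 G \<theta> X" and ?C = "theta_class G \<theta>"
  let ?S = "reflection G \<theta> ` X"
  have C: "?C \<subseteq> carrier ?E"
    using reflection_carrier by (auto simp flip: reflection_image)
  have invol: "c \<otimes>\<^bsub>?E\<^esub> c = \<one>\<^bsub>?E\<^esub>" if "c \<in> ?C" for c
    using that reflection_square by (auto simp flip: reflection_image)
  have SC: "?S \<subseteq> ?C"
    using X by (auto simp flip: reflection_image)
  have F: "subgroup ?F ?E"
    using F2_eq_generate_reflection[OF X o] E.generate_is_subgroup[of ?S] SC C by auto
  have t: "theta_bar G \<in> ?F"
    by (auto simp: F2_def intro: generate.incl)
  have mem: "emb (cartan_map G \<theta> x) \<in> ?F \<longleftrightarrow> reflection G \<theta> x \<in> ?F"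
    if "x \<in> sym_space G \<theta>" for x
  proof
    assume "reflection G \<theta> x \<in> ?F"
    then have "reflection G \<theta> x \<otimes>\<^bsub>?E\<^esub> inv\<^bsub>?E\<^esub> theta_bar G \<in> ?F"
      using F t by (simp add: subgroup.m_closed subgroup.m_inv_closed)
    then show "emb (cartan_map G \<theta> x) \<in> ?F"
      using that emb_carrier cartan_map_carrier theta_bar_carrier
      by (simp add: reflection_def E.m_assoc)
  qed (use F t in \<open>simp add: reflection_def subgroup.m_closed\<close>)
  have "{x \<in> sym_space G \<theta>. emb (cartan_map G \<theta> x) \<in> ?F \<inter> (?C #>\<^bsub>?E\<^esub> inv\<^bsub>?E\<^esub> theta_bar G)} =
      {x \<in> sym_space G \<theta>. reflection G \<theta> x \<in> ?F}" (is "?X' = _")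
    using mem emb_cartan_map_in_class by auto
  moreover have "reflection G \<theta> ` {x \<in> sym_space G \<theta>. reflection G \<theta> x \<in> ?F} = ?F \<inter> ?C"
    by (auto simp flip: reflection_image)
  ultimately have "?S = ?F \<inter> ?C \<longleftrightarrow> X = ?X'"
    using inj_on_image_eq_iff[OF inj_on_reflection X, of ?X'] by auto
  moreover have "X \<noteq> {}"
    using o by blast
  ultimately show ?thesis
    using maximal_antipodal_set_iff[OF X] E.maximal_commuting_iff[OF C invol SC]
    by (simp add: F2_eq_generate_reflection[OF X o] theta_generated_elab_def)
qed

end

end

theorem theorem1p1:
  fixes G :: "('a, 'b) monoid_scheme"
    and T :: "'a topology"
    and A :: "('a, 'e::real_normed_vector) chart set"
    and \<theta> :: "'a \<Rightarrow> 'a"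
    and X :: "'a set set"
  assumes "lie_group G T A"
    and "compact_space T"
    and "connected_space T"
    and "involutive_automorphism G \<theta>"
    and "smooth_map T A T A \<theta>"
    and "X \<subseteq> sym_space G \<theta>"
    and "origin G \<theta> \<in> X"
  shows "maximal_antipodal_set G \<theta> X \<longleftrightarrow>
    maximal_element (F2 G \<theta> X) (theta_generated_elab G \<theta>) \<and>
    X = {x \<in> sym_space G \<theta>. emb (cartan_map G \<theta> x) \<in>
           F2 G \<theta> X \<inter> (theta_class G \<theta> #>\<^bsub>ext_group G \<theta>\<^esub> inv\<^bsub>ext_group G \<theta>\<^esub> theta_bar G)}"
  using assms(4,6,7) lie_group.axioms(1)[OF assms(1)]
  by (intro group.maximal_antipodal_set_iff_maximal_F2)

end
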